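(* Let $R$ be a $C$-algebra, $Z$ an injective cogenerator in the category of (right) $C$-modules, $R^*=\mathrm{Hom}_C(R,Z)$, $C'=\mathrm{End}_C(Z)$ and $R^{**}=\mathrm{Hom}_{C'}(R^*,Z)$. Regard $R^*$ as a right $R$-module in the usual way. (i) The ring $\mathrm{End}_R(R^* )$ consists of left multiplications by all elements of $R^{**}$, while $\mathrm{Biend}_R(R^* )$ consists of right multiplications by all elements $s\in R^{**}$ satisfying $s\cdot t=s\diamond t$ for all $t\in R^{**}$. (ii) $\mathrm{Biend}_R(R^* )$ consists of right multiplications by elements $s\in R^{**}$ such that for each finite subset $F$ of $R^*$ there exists an element $r_F\in R$ satisfying $\rho s=\rho r_F$ for all $\rho\in F$. (iii) If $R$ is linearly compact as a right $R$-module, then $\mathrm{Biend}_R(R^* )=R$.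
   Context: All rings and modules are unital. A $C$-algebra is a ring $R$ containing $C$ as a subring of its center, with the same identity (so $C$ is commutative). A cogenerator $Z$ is a $C$-module such that for every $C$-module $W$ and $0\ne w\in W$ there is $f\in\mathrm{Hom}_C(W,Z)$ with $f(w)\ne0$. $R^*$ is a left $C'$-module via $t\rho=t\circ\rho$ ($t\in C'$). Actions of $R$ on $R^*$: for $r,x\in R$, $\rho\in R^*$, $(r\rho)(x)=\rho(xr)$ and $(\rho r)(x)=\rho(rx)$. Actions of $s\in R^{**}$ on $R^*$: $(\rho s)(r)=s(r\rho)$ (right multiplication by $s$) and $(s\rho)(r)=s(\rho r)$ (left multiplication by $s$). Arens products on $R^{**}$: $(s\cdot t)(\rho)=s(t\rho)$ and $(s\diamond t)(\rho)=t(\rho s)$ for $s,t\in R^{**}$, $\rho\in R^*$. $\mathrm{Biend}_R(R^* )=\mathrm{End}_{\mathrm{End}_R(R^* )}(R^* )$ is the ring of additive maps on $R^*$ commuting with all endomorphisms of the right $R$-module $R^*$, with biendomorphisms acting from the right (multiplication is the reverse of composition); $R$ is regarded as a subring of it via right multiplications $\rho\mapsto\rho r$, and $\mathrm{Biend}_R(R^* )=R$ means that these are all the biendomorphisms. A module $U$ is linearly compact if for any family of submodules $U_i$ of $U$ and elements $u_i\in U$, the system of relations $x-u_i\in U_i$ has a solution $x\in U$ provided every finite subsystem has a solution.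
   Formalization: In (i), the left multipliers and the elements t range over Hom_C(R*,Z) instead of R** = Hom_{C'}(R*,Z); as printed (i) is false (C=R=k a field, Z=k²: End_R(R* )=M_2(k) but R**=k). The elements s still range over R**; (ii), (iii) are unchanged. *)

theory Defs
  imports "HOL-Algebra.Algebra"
begin

text \<open>
  Conventions. A right module over a ring \<open>K\<close> is held in a \<open>module\<close> record \<open>M\<close> whose field
  \<open>smult\<close> is the right action: \<open>k \<odot>\<^bsub>M\<^esub> m\<close> stands for \<open>m k\<close>. Over the commutative ring \<open>C\<close> the
  library locale \<open>module\<close> describes such modules; the library predicate \<open>submodule\<close> makes sense
  (closure under addition, negation and the action) for noncommutative \<open>K\<close> as well.
  Maps are extensional, i.e. \<open>undefined\<close> outside the carrier, so that equality of functions is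
  equality of maps on the carrier.
\<close>

section \<open>Modules\<close>

definition C_algebra :: "'a set \<Rightarrow> ('a, 'x) ring_scheme \<Rightarrow> bool" where
  "C_algebra C R \<longleftrightarrow> ring R \<and> subring C R \<and>
     (\<forall>c\<in>C. \<forall>r\<in>carrier R. c \<otimes>\<^bsub>R\<^esub> r = r \<otimes>\<^bsub>R\<^esub> c)"

abbreviation scalars :: "'a set \<Rightarrow> ('a, 'x) ring_scheme \<Rightarrow> ('a, 'x) ring_scheme" where
  "scalars C R \<equiv> R\<lparr>carrier := C\<rparr>"

definition mod_hom ::
  "('a, 'x) ring_scheme \<Rightarrow> ('a, 'm, 'v) module_scheme \<Rightarrow> ('a, 'n, 'w) module_scheme \<Rightarrow> ('m \<Rightarrow> 'n) set"
  where
  "mod_hom K M N = {f \<in> carrier M \<rightarrow>\<^sub>E carrier N.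
     (\<forall>x\<in>carrier M. \<forall>y\<in>carrier M. f (x \<oplus>\<^bsub>M\<^esub> y) = f x \<oplus>\<^bsub>N\<^esub> f y) \<and>
     (\<forall>k\<in>carrier K. \<forall>x\<in>carrier M. f (k \<odot>\<^bsub>M\<^esub> x) = k \<odot>\<^bsub>N\<^esub> f x)}"

text \<open>The ring of additive maps commuting with all endomorphisms of the \<open>K\<close>-module \<open>M\<close>
  (given by its underlying set).\<close>

definition biend :: "('a, 'x) ring_scheme \<Rightarrow> ('a, 'm, 'v) module_scheme \<Rightarrow> ('m \<Rightarrow> 'm) set" where
  "biend K M = {b \<in> carrier M \<rightarrow>\<^sub>E carrier M.
     (\<forall>x\<in>carrier M. \<forall>y\<in>carrier M. b (x \<oplus>\<^bsub>M\<^esub> y) = b x \<oplus>\<^bsub>M\<^esub> b y) \<and>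
     (\<forall>f\<in>mod_hom K M M. \<forall>x\<in>carrier M. b (f x) = f (b x))}"

text \<open>
  Injectivity and the cogenerator property quantify over all \<open>C\<close>-modules. In HOL the carriers of
  these test modules have to live in some type \<open>'u\<close>, passed as a type argument. As soon as \<open>'u\<close> is
  at least as large as the type containing \<open>C\<close>, the two properties together do not depend on
  \<open>'u\<close>: by Baer's criterion injectivity only needs the inclusions of ideals into \<open>C\<close>, and then
  the cogenerator property only needs cyclic modules, which are of the form \<open>C/I\<close>.
\<close>

definition injective_module ::
  "'u itself \<Rightarrow> ('a, 'x) ring_scheme \<Rightarrow> ('a, 'b, 'y) module_scheme \<Rightarrow> bool" where
  "injective_module _ K Z \<longleftrightarrow> module K Z \<and>
     (\<forall>(N :: ('a, 'u) module) (M :: ('a, 'u) module) i f.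
        module K N \<and> module K M \<and> i \<in> mod_hom K N M \<and> inj_on i (carrier N) \<and> f \<in> mod_hom K N Z
        \<longrightarrow> (\<exists>g\<in>mod_hom K M Z. \<forall>x\<in>carrier N. g (i x) = f x))"

definition cogenerator ::
  "'u itself \<Rightarrow> ('a, 'x) ring_scheme \<Rightarrow> ('a, 'b, 'y) module_scheme \<Rightarrow> bool" where
  "cogenerator _ K Z \<longleftrightarrow> module K Z \<and>
     (\<forall>(W :: ('a, 'u) module) w.
        module K W \<and> w \<in> carrier W \<and> w \<noteq> \<zero>\<^bsub>W\<^esub> \<longrightarrow> (\<exists>f\<in>mod_hom K W Z. f w \<noteq> \<zero>\<^bsub>Z\<^esub>))"

text \<open>A test type containing copies of the rings, modules, duals and finite powers of duals
  involved, as well as of their quotients (whose elements are cosets).\<close>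

type_synonym ('a, 'b) test = "('a \<times> (nat \<Rightarrow> 'a \<Rightarrow> 'b)) set"

text \<open>A family of pairs \<open>(U\<^sub>i, u\<^sub>i)\<close> is given by the set \<open>S\<close> of its members: repeated pairs
  repeat the same relation.\<close>

definition linearly_compact :: "('a, 'x) ring_scheme \<Rightarrow> ('a, 'm, 'v) module_scheme \<Rightarrow> bool" where
  "linearly_compact K U \<longleftrightarrow>
     (\<forall>S \<subseteq> {N. submodule N K U} \<times> carrier U.
        (\<forall>T \<subseteq> S. finite T \<longrightarrow> (\<exists>x\<in>carrier U. \<forall>(N, u)\<in>T. x \<ominus>\<^bsub>U\<^esub> u \<in> N))
        \<longrightarrow> (\<exists>x\<in>carrier U. \<forall>(N, u)\<in>S. x \<ominus>\<^bsub>U\<^esub> u \<in> N))"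

section \<open>The dual of an algebra\<close>

text \<open>\<open>R\<close> as a right module over itself, and by restriction of scalars over \<open>C\<close>.\<close>

definition right_regular :: "('a, 'x) ring_scheme \<Rightarrow> ('a, 'a) module" where
  "right_regular R = \<lparr>carrier = carrier R, monoid.mult = monoid.mult R, one = one R,
     ring.zero = ring.zero R, ring.add = ring.add R, smult = (\<lambda>r x. x \<otimes>\<^bsub>R\<^esub> r)\<rparr>"

definition lact :: "('a, 'x) ring_scheme \<Rightarrow> 'a \<Rightarrow> ('a \<Rightarrow> 'b) \<Rightarrow> ('a \<Rightarrow> 'b)" where
  "lact R r \<rho> = (\<lambda>x\<in>carrier R. \<rho> (x \<otimes>\<^bsub>R\<^esub> r))"

definition ract :: "('a, 'x) ring_scheme \<Rightarrow> ('a \<Rightarrow> 'b) \<Rightarrow> 'a \<Rightarrow> ('a \<Rightarrow> 'b)" where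
  "ract R \<rho> r = (\<lambda>x\<in>carrier R. \<rho> (r \<otimes>\<^bsub>R\<^esub> x))"

text \<open>\<open>R\<^sup>* = Hom\<^sub>C(R, Z)\<close> as a right \<open>R\<close>-module. The fields \<open>mult\<close> and \<open>one\<close> of the record have no
  meaning for a module. Restricted to scalars in \<open>C\<close>, the action is the usual \<open>C\<close>-module structure,
  as \<open>(\<rho> c) x = \<rho> (c x)\<close> is \<open>\<rho> x\<close> times \<open>c\<close>.\<close>

definition dual ::
  "('a, 'x) ring_scheme \<Rightarrow> 'a set \<Rightarrow> ('a, 'b, 'y) module_scheme \<Rightarrow> ('a, 'a \<Rightarrow> 'b) module" where
  "dual R C Z = \<lparr>carrier = mod_hom (scalars C R) (right_regular R) Z,
     monoid.mult = undefined, one = undefined,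
     ring.zero = (\<lambda>x\<in>carrier R. \<zero>\<^bsub>Z\<^esub>),
     ring.add = (\<lambda>\<rho> \<sigma>. \<lambda>x\<in>carrier R. \<rho> x \<oplus>\<^bsub>Z\<^esub> \<sigma> x),
     smult = (\<lambda>r \<rho>. ract R \<rho> r)\<rparr>"

text \<open>\<open>R\<^sup>*\<^sup>* = Hom\<^bsub>C'\<^esub>(R\<^sup>*, Z)\<close>, where \<open>C' = End\<^sub>C(Z)\<close> acts on \<open>R\<^sup>*\<close> by composition.\<close>

definition bidual ::
  "('a, 'x) ring_scheme \<Rightarrow> 'a set \<Rightarrow> ('a, 'b, 'y) module_scheme \<Rightarrow> (('a \<Rightarrow> 'b) \<Rightarrow> 'b) set" where
  "bidual R C Z = {s \<in> carrier (dual R C Z) \<rightarrow>\<^sub>E carrier Z.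
     (\<forall>\<rho>\<in>carrier (dual R C Z). \<forall>\<sigma>\<in>carrier (dual R C Z).
        s (\<rho> \<oplus>\<^bsub>dual R C Z\<^esub> \<sigma>) = s \<rho> \<oplus>\<^bsub>Z\<^esub> s \<sigma>) \<and>
     (\<forall>t\<in>mod_hom (scalars C R) Z Z. \<forall>\<rho>\<in>carrier (dual R C Z).
        s (compose (carrier R) t \<rho>) = t (s \<rho>))}"

text \<open>\<open>Hom\<^sub>C(R\<^sup>*, Z)\<close>, which contains \<open>R\<^sup>*\<^sup>*\<close>. The two agree when \<open>C'\<close> consists of multiplications by
  elements of \<open>C\<close>, but not in general. The ring \<open>End\<^sub>R(R\<^sup>*)\<close> contains \<open>C'\<close> and is isomorphic to
  \<open>Hom\<^sub>C(R\<^sup>*, Z)\<close> via \<open>f \<mapsto> (\<rho> \<mapsto> f \<rho> 1)\<close>, so it is not in general given by the left multiplications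
  by elements of \<open>R\<^sup>*\<^sup>*\<close>: if \<open>C = R\<close> is a field and \<open>Z = C\<^sup>2\<close>, then \<open>End\<^sub>R(R\<^sup>*) = M\<^sub>2(C)\<close> but
  \<open>R\<^sup>*\<^sup>* = C\<close>. Likewise, for \<open>C = \<int>\<close>, \<open>Z = \<rat>/\<int>\<close>, \<open>R = \<rat>\<close> the ring \<open>R\<^sup>*\<^sup>*\<close> is commutative and larger
  than \<open>Biend\<^sub>R(R\<^sup>*) = \<rat>\<close>. Therefore left multiplications are taken by elements of \<open>Hom\<^sub>C(R\<^sup>*, Z)\<close>.\<close>

definition full_bidual ::
  "('a, 'x) ring_scheme \<Rightarrow> 'a set \<Rightarrow> ('a, 'b, 'y) module_scheme \<Rightarrow> (('a \<Rightarrow> 'b) \<Rightarrow> 'b) set" where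
  "full_bidual R C Z = mod_hom (scalars C R) (dual R C Z) Z"

text \<open>The elements \<open>\<rho> s\<close> and \<open>s \<rho>\<close> of \<open>R\<^sup>*\<close>.\<close>

definition rmult :: "('a, 'x) ring_scheme \<Rightarrow> ('a \<Rightarrow> 'b) \<Rightarrow> (('a \<Rightarrow> 'b) \<Rightarrow> 'b) \<Rightarrow> ('a \<Rightarrow> 'b)" where
  "rmult R \<rho> s = (\<lambda>r\<in>carrier R. s (lact R r \<rho>))"

definition lmult :: "('a, 'x) ring_scheme \<Rightarrow> (('a \<Rightarrow> 'b) \<Rightarrow> 'b) \<Rightarrow> ('a \<Rightarrow> 'b) \<Rightarrow> ('a \<Rightarrow> 'b)" where
  "lmult R s \<rho> = (\<lambda>r\<in>carrier R. s (ract R \<rho> r))"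

text \<open>The two Arens products \<open>s \<cdot> t\<close> and \<open>s \<diamondop> t\<close>.\<close>

definition arens_dot ::
  "('a, 'x) ring_scheme \<Rightarrow> 'a set \<Rightarrow> ('a, 'b, 'y) module_scheme
     \<Rightarrow> (('a \<Rightarrow> 'b) \<Rightarrow> 'b) \<Rightarrow> (('a \<Rightarrow> 'b) \<Rightarrow> 'b) \<Rightarrow> (('a \<Rightarrow> 'b) \<Rightarrow> 'b)" where
  "arens_dot R C Z s t = (\<lambda>\<rho>\<in>carrier (dual R C Z). s (lmult R t \<rho>))"

definition arens_diamond ::
  "('a, 'x) ring_scheme \<Rightarrow> 'a set \<Rightarrow> ('a, 'b, 'y) module_scheme
     \<Rightarrow> (('a \<Rightarrow> 'b) \<Rightarrow> 'b) \<Rightarrow> (('a \<Rightarrow> 'b) \<Rightarrow> 'b) \<Rightarrow> (('a \<Rightarrow> 'b) \<Rightarrow> 'b)" where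
  "arens_diamond R C Z s t = (\<lambda>\<rho>\<in>carrier (dual R C Z). t (rmult R \<rho> s))"

text \<open>Multiplications as maps on \<open>R\<^sup>*\<close>.\<close>

definition left_mult_map where
  "left_mult_map R C Z s = (\<lambda>\<rho>\<in>carrier (dual R C Z). lmult R s \<rho>)"

definition right_mult_map where
  "right_mult_map R C Z s = (\<lambda>\<rho>\<in>carrier (dual R C Z). rmult R \<rho> s)"

definition right_mult_by where
  "right_mult_by R C Z r = (\<lambda>\<rho>\<in>carrier (dual R C Z). ract R \<rho> r)"

end

theory Submission
  imports Defs
begin

text \<open>
  An \<open>R\<close>-endomorphism \<open>f\<close> of \<open>R\<^sup>*\<close> is determined by the functional \<open>t \<rho> = f \<rho> 1\<close>, as
  \<open>f \<rho> r = (f \<rho>) r 1 = f (\<rho> r) 1 = t (\<rho> r)\<close>. A biendomorphism \<open>b\<close> commutes with the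
  endomorphisms \<open>\<rho> \<mapsto> r \<rho>\<close>, so in the same way it is determined by \<open>s \<rho> = b \<rho> 1\<close>, and commuting
  with left multiplication by all \<open>t\<close> is the equality of the two Arens products.

  For (ii), let \<open>\<rho>\<^sub>1, \<dots>, \<rho>\<^sub>n \<in> R\<^sup>*\<close>. If \<open>(\<rho>\<^sub>1 s, \<dots>, \<rho>\<^sub>n s)\<close> is not in the submodule of all
  \<open>(\<rho>\<^sub>1 r, \<dots>, \<rho>\<^sub>n r)\<close>, the cogenerator \<open>Z\<close> gives \<open>t\<^sub>1, \<dots>, t\<^sub>n\<close> with \<open>\<Sum> t\<^sub>i (\<rho>\<^sub>i r) = 0\<close> for all \<open>r\<close>,
  i.e. \<open>\<Sum> t\<^sub>i \<rho>\<^sub>i = 0\<close>, but \<open>\<Sum> t\<^sub>i (\<rho>\<^sub>i s) \<noteq> 0\<close>. This contradicts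
  \<open>\<Sum> t\<^sub>i (\<rho>\<^sub>i s) = \<Sum> s (t\<^sub>i \<rho>\<^sub>i) = s (\<Sum> t\<^sub>i \<rho>\<^sub>i) = 0\<close>. Linear compactness, applied to the right ideals
  \<open>{r. \<rho> r = 0}\<close>, then yields a single \<open>r\<close> for all \<open>\<rho>\<close>, which is (iii).
\<close>

section \<open>Quotients and powers of modules\<close>

lemma mod_homI:
  assumes "f \<in> carrier M \<rightarrow>\<^sub>E carrier N"
    and "\<And>x y. x \<in> carrier M \<Longrightarrow> y \<in> carrier M \<Longrightarrow> f (x \<oplus>\<^bsub>M\<^esub> y) = f x \<oplus>\<^bsub>N\<^esub> f y"
    and "\<And>k x. k \<in> carrier K \<Longrightarrow> x \<in> carrier M \<Longrightarrow> f (k \<odot>\<^bsub>M\<^esub> x) = k \<odot>\<^bsub>N\<^esub> f x"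
  shows "f \<in> mod_hom K M N"
  using assms by (simp add: mod_hom_def)

lemma mod_homD:
  assumes "f \<in> mod_hom K M N"
  shows "f \<in> carrier M \<rightarrow>\<^sub>E carrier N"
    and "\<And>x. x \<in> carrier M \<Longrightarrow> f x \<in> carrier N"
    and "\<And>x y. x \<in> carrier M \<Longrightarrow> y \<in> carrier M \<Longrightarrow> f (x \<oplus>\<^bsub>M\<^esub> y) = f x \<oplus>\<^bsub>N\<^esub> f y"
    and "\<And>k x. k \<in> carrier K \<Longrightarrow> x \<in> carrier M \<Longrightarrow> f (k \<odot>\<^bsub>M\<^esub> x) = k \<odot>\<^bsub>N\<^esub> f x"
  using assms by (auto simp: mod_hom_def)

lemma restrict_eq_iff: "restrict f A = restrict g A \<longleftrightarrow> (\<forall>x\<in>A. f x = g x)"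
  by (metis restrict_apply' restrict_ext)

lemma additive_zero:
  assumes "abelian_group M" "abelian_group N"
    and "\<And>x. x \<in> carrier M \<Longrightarrow> f x \<in> carrier N"
    and "\<And>x y. x \<in> carrier M \<Longrightarrow> y \<in> carrier M \<Longrightarrow> f (x \<oplus>\<^bsub>M\<^esub> y) = f x \<oplus>\<^bsub>N\<^esub> f y"
  shows "f \<zero>\<^bsub>M\<^esub> = \<zero>\<^bsub>N\<^esub>"
proof -
  interpret M: abelian_group M by fact
  interpret N: abelian_group N by fact
  have "f \<zero>\<^bsub>M\<^esub> \<oplus>\<^bsub>N\<^esub> f \<zero>\<^bsub>M\<^esub> = f \<zero>\<^bsub>M\<^esub>"
    using assms(4)[of "\<zero>\<^bsub>M\<^esub>" "\<zero>\<^bsub>M\<^esub>"] by simp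
  then show ?thesis using assms(3)[of "\<zero>\<^bsub>M\<^esub>"] by simp
qed

text \<open>The quotient is presented through an arbitrary map \<open>q\<close> whose fibres are the
  cosets of N, so that its elements may live in any type. The hypothesis on \<open>q\<close> makes
  the operations independent of the chosen representatives.\<close>

lemma (in module) exists_quotient_module:
  fixes q :: "'c \<Rightarrow> 'e"
  assumes N: "submodule N R M"
    and "\<forall>x\<in>carrier M. \<forall>y\<in>carrier M. q x = q y \<longleftrightarrow> x \<ominus>\<^bsub>M\<^esub> y \<in> N"
  shows "\<exists>W :: ('a, 'e) module. module R W \<and> carrier W = q ` carrier M \<and> \<zero>\<^bsub>W\<^esub> = q \<zero>\<^bsub>M\<^esub> \<and>
    (\<forall>x\<in>carrier M. \<forall>y\<in>carrier M. q (x \<oplus>\<^bsub>M\<^esub> y) = q x \<oplus>\<^bsub>W\<^esub> q y) \<and>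
    (\<forall>a\<in>carrier R. \<forall>x\<in>carrier M. q (a \<odot>\<^bsub>M\<^esub> x) = a \<odot>\<^bsub>W\<^esub> q x)"
proof -
  note N' = submoduleE[OF N]
  note q = assms(2)[rule_format]
  \<comment> \<open>A chosen representative in each class; the operations of \<open>W\<close> are
    those of M applied to representatives.\<close>
  define p where "p = inv_into (carrier M) q"
  define W :: "('a, 'e) module" where "W = \<lparr>carrier = q ` carrier M,
     monoid.mult = undefined, one = undefined, ring.zero = q \<zero>\<^bsub>M\<^esub>,
     ring.add = (\<lambda>u v. q (p u \<oplus>\<^bsub>M\<^esub> p v)), smult = (\<lambda>a u. q (a \<odot>\<^bsub>M\<^esub> p u))\<rparr>"
  have p: "p (q x) \<in> carrier M" "q (p (q x)) = q x" if "x \<in> carrier M" for x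
    using that by (auto simp: p_def inv_into_into f_inv_into_f)
  have diff: "(x \<oplus>\<^bsub>M\<^esub> y) \<ominus>\<^bsub>M\<^esub> (x' \<oplus>\<^bsub>M\<^esub> y') = (x \<ominus>\<^bsub>M\<^esub> x') \<oplus>\<^bsub>M\<^esub> (y \<ominus>\<^bsub>M\<^esub> y')"
    if "x \<in> carrier M" "y \<in> carrier M" "x' \<in> carrier M" "y' \<in> carrier M" for x y x' y'
    using that by (simp add: M.minus_eq M.minus_add M.a_ac)
  have add: "q (x \<oplus>\<^bsub>M\<^esub> y) = q x \<oplus>\<^bsub>W\<^esub> q y" if "x \<in> carrier M" "y \<in> carrier M" for x y
  proof -
    have "x \<ominus>\<^bsub>M\<^esub> p (q x) \<in> N" "y \<ominus>\<^bsub>M\<^esub> p (q y) \<in> N"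
      using that p by (simp_all flip: q)
    then have "(x \<oplus>\<^bsub>M\<^esub> y) \<ominus>\<^bsub>M\<^esub> (p (q x) \<oplus>\<^bsub>M\<^esub> p (q y)) \<in> N"
      using that p N'(5) by (simp add: diff)
    then have "q (x \<oplus>\<^bsub>M\<^esub> y) = q (p (q x) \<oplus>\<^bsub>M\<^esub> p (q y))"
      using that p by (simp add: q)
    then show ?thesis by (simp add: W_def)
  qed
  have smult: "q (a \<odot>\<^bsub>M\<^esub> x) = a \<odot>\<^bsub>W\<^esub> q x" if "a \<in> carrier R" "x \<in> carrier M" for a x
  proof -
    have "x \<ominus>\<^bsub>M\<^esub> p (q x) \<in> N"
      using that p by (simp flip: q)
    then have "a \<odot>\<^bsub>M\<^esub> (x \<ominus>\<^bsub>M\<^esub> p (q x)) \<in> N"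
      using that N'(4) by simp
    then have "a \<odot>\<^bsub>M\<^esub> x \<ominus>\<^bsub>M\<^esub> a \<odot>\<^bsub>M\<^esub> p (q x) \<in> N"
      using that p by (simp add: M.minus_eq smult_r_distr smult_r_minus)
    then have "q (a \<odot>\<^bsub>M\<^esub> x) = q (a \<odot>\<^bsub>M\<^esub> p (q x))"
      using that p by (simp add: q)
    then show ?thesis by (simp add: W_def)
  qed
  have carrier: "carrier W = q ` carrier M" and zero: "\<zero>\<^bsub>W\<^esub> = q \<zero>\<^bsub>M\<^esub>"
    by (simp_all add: W_def)
  have "module R W"
  proof (rule moduleI)
    show "cring R" ..
    show "abelian_group W"
    proof (rule abelian_groupI)
      fix u assume "u \<in> carrier W"
      then obtain x where "x \<in> carrier M" "u = q x" by (auto simp: carrier)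
      then show "\<exists>v\<in>carrier W. v \<oplus>\<^bsub>W\<^esub> u = \<zero>\<^bsub>W\<^esub>"
        by (intro bexI[of _ "q (\<ominus>\<^bsub>M\<^esub> x)"]) (auto simp: carrier zero M.l_neg simp flip: add)
    qed (auto simp: carrier zero M.a_ac simp flip: add)
  qed (auto simp: carrier smult_l_distr smult_r_distr smult_assoc1 simp flip: add smult)
  then show ?thesis
    using carrier zero add smult by blast
qed

text \<open>The injection \<open>j\<close> moves \<open>M\<close> into the type over which the cogenerator property is tested.\<close>

lemma cogenerator_separates_submodule:
  fixes M :: "('a, 'm, 'v) module_scheme" and j :: "'m \<Rightarrow> 'e"
  assumes Z: "cogenerator TYPE('e set) K Z" and M: "module K M"
    and N: "submodule N K M" and x: "x \<in> carrier M" "x \<notin> N" and j: "inj_on j (carrier M)"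
  shows "\<exists>f\<in>mod_hom K M Z. (\<forall>y\<in>N. f y = \<zero>\<^bsub>Z\<^esub>) \<and> f x \<noteq> \<zero>\<^bsub>Z\<^esub>"
proof -
  interpret module K M by fact
  interpret Z: module K Z using Z by (simp add: cogenerator_def)
  note N' = submoduleE[OF N]
  \<comment> \<open>The coset of x modulo N, transported by \<open>j\<close> so that it is an
    element of \<open>'e set\<close>, the type over which Z is tested.\<close>
  define q where "q x = j ` {y \<in> carrier M. y \<ominus>\<^bsub>M\<^esub> x \<in> N}" for x
  have zero: "\<zero>\<^bsub>M\<^esub> \<in> N"
    using N'(2,3,5) N'(1) by (metis M.r_neg ex_in_conv subsetD)
  have q: "q y = q z \<longleftrightarrow> y \<ominus>\<^bsub>M\<^esub> z \<in> N" if yz: "y \<in> carrier M" "z \<in> carrier M" for y z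
  proof
    assume "q y = q z"
    then have "{w \<in> carrier M. w \<ominus>\<^bsub>M\<^esub> y \<in> N} = {w \<in> carrier M. w \<ominus>\<^bsub>M\<^esub> z \<in> N}"
      unfolding q_def by (subst (asm) inj_on_image_eq_iff[OF j]) auto
    moreover have "y \<ominus>\<^bsub>M\<^esub> y \<in> N" using zero yz by (simp add: M.minus_eq M.r_neg)
    ultimately show "y \<ominus>\<^bsub>M\<^esub> z \<in> N" using yz by blast
  next
    assume yzN: "y \<ominus>\<^bsub>M\<^esub> z \<in> N"
    have trans: "w \<ominus>\<^bsub>M\<^esub> v \<in> N"
      if "w \<ominus>\<^bsub>M\<^esub> u \<in> N" "u \<ominus>\<^bsub>M\<^esub> v \<in> N" "u \<in> carrier M" "v \<in> carrier M" "w \<in> carrier M" for u v w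
    proof -
      have "(w \<ominus>\<^bsub>M\<^esub> u) \<oplus>\<^bsub>M\<^esub> (u \<ominus>\<^bsub>M\<^esub> v) \<in> N" using that N'(5) by blast
      also have "(w \<ominus>\<^bsub>M\<^esub> u) \<oplus>\<^bsub>M\<^esub> (u \<ominus>\<^bsub>M\<^esub> v) = w \<ominus>\<^bsub>M\<^esub> v"
        using that by (simp add: M.minus_eq M.a_assoc M.r_neg1)
      finally show ?thesis .
    qed
    have "z \<ominus>\<^bsub>M\<^esub> y = \<ominus>\<^bsub>M\<^esub> (y \<ominus>\<^bsub>M\<^esub> z)"
      using yz by (simp add: M.minus_eq M.minus_add M.a_comm)
    then have "z \<ominus>\<^bsub>M\<^esub> y \<in> N" using yzN N'(3) by simp
    then have "w \<ominus>\<^bsub>M\<^esub> y \<in> N \<longleftrightarrow> w \<ominus>\<^bsub>M\<^esub> z \<in> N" if "w \<in> carrier M" for w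
      using that yz yzN trans by blast
    then show "q y = q z" unfolding q_def by (intro arg_cong[of _ _ "image j"]) blast
  qed
  obtain W :: "('a, 'e set) module" where W: "module K W" "carrier W = q ` carrier M"
    "\<zero>\<^bsub>W\<^esub> = q \<zero>\<^bsub>M\<^esub>"
    "\<forall>x\<in>carrier M. \<forall>y\<in>carrier M. q (x \<oplus>\<^bsub>M\<^esub> y) = q x \<oplus>\<^bsub>W\<^esub> q y"
    "\<forall>a\<in>carrier K. \<forall>x\<in>carrier M. q (a \<odot>\<^bsub>M\<^esub> x) = a \<odot>\<^bsub>W\<^esub> q x"
    using exists_quotient_module[OF N, of q] q by (auto intro: that)
  have minus_zero: "\<ominus>\<^bsub>M\<^esub> \<zero>\<^bsub>M\<^esub> = \<zero>\<^bsub>M\<^esub>"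
    by (rule M.minus_equality) simp_all
  have q_zero: "q y = \<zero>\<^bsub>W\<^esub> \<longleftrightarrow> y \<in> N" if "y \<in> carrier M" for y
    using that W(3) q by (simp add: M.minus_eq minus_zero)
  \<comment> \<open>The class of x is nonzero as x lies outside N, so the cogenerator property
    applies to the quotient; the required map is g after q.\<close>
  obtain g where g: "g \<in> mod_hom K W Z" "g (q x) \<noteq> \<zero>\<^bsub>Z\<^esub>"
    using Z[unfolded cogenerator_def, THEN conjunct2, rule_format, of W "q x"] W(1,2) q_zero x
    by auto
  note g' = mod_homD[OF g(1)]
  have g_zero: "g \<zero>\<^bsub>W\<^esub> = \<zero>\<^bsub>Z\<^esub>"
    using g' W(1) by (intro additive_zero) (auto intro: module.axioms Z.abelian_group_axioms)
  show ?thesis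
  proof (intro bexI conjI ballI)
    show "(\<lambda>y\<in>carrier M. g (q y)) \<in> mod_hom K M Z"
      by (rule mod_homI) (auto simp: W g')
    fix y assume "y \<in> N"
    then show "(\<lambda>y\<in>carrier M. g (q y)) y = \<zero>\<^bsub>Z\<^esub>"
      using N'(1) q_zero[of y] g_zero by auto
  qed (use g x in auto)
qed

text \<open>Packs finitely many functionals into one element of a module, so that a finite system of
  equations becomes a single membership. The families are extensional, hence equality of functions
  is equality of families.\<close>

definition power_module :: "'i set \<Rightarrow> ('a, 'm, 'v) module_scheme \<Rightarrow> ('a, 'i \<Rightarrow> 'm) module" where
  "power_module I M = \<lparr>carrier = I \<rightarrow>\<^sub>E carrier M, monoid.mult = undefined, one = undefined,
     ring.zero = (\<lambda>i\<in>I. \<zero>\<^bsub>M\<^esub>), ring.add = (\<lambda>v w. \<lambda>i\<in>I. v i \<oplus>\<^bsub>M\<^esub> w i),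
     smult = (\<lambda>a v. \<lambda>i\<in>I. a \<odot>\<^bsub>M\<^esub> v i)\<rparr>"

lemma power_module_simps [simp]:
  "carrier (power_module I M) = I \<rightarrow>\<^sub>E carrier M"
  "\<zero>\<^bsub>power_module I M\<^esub> = (\<lambda>i\<in>I. \<zero>\<^bsub>M\<^esub>)"
  "v \<oplus>\<^bsub>power_module I M\<^esub> w = (\<lambda>i\<in>I. v i \<oplus>\<^bsub>M\<^esub> w i)"
  "a \<odot>\<^bsub>power_module I M\<^esub> v = (\<lambda>i\<in>I. a \<odot>\<^bsub>M\<^esub> v i)"
  by (simp_all add: power_module_def)

lemma (in module) power_module: "module R (power_module I M)"
proof (rule moduleI)
  show "cring R" ..
  show "abelian_group (power_module I M)"
  proof (rule abelian_groupI)
    fix v assume v: "v \<in> carrier (power_module I M)"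
    then show "\<exists>w\<in>carrier (power_module I M). w \<oplus>\<^bsub>power_module I M\<^esub> v = \<zero>\<^bsub>power_module I M\<^esub>"
      by (intro bexI[of _ "\<lambda>i\<in>I. \<ominus>\<^bsub>M\<^esub> v i"]) (auto simp: PiE_iff M.l_neg intro!: restrict_ext)
    show "\<zero>\<^bsub>power_module I M\<^esub> \<oplus>\<^bsub>power_module I M\<^esub> v = v"
      using v by (intro extensionalityI[of _ I]) (auto simp: PiE_iff)
  qed (auto simp: PiE_iff M.a_ac intro!: restrict_ext)
  show "\<one> \<odot>\<^bsub>power_module I M\<^esub> v = v" if "v \<in> carrier (power_module I M)" for v
    using that by (intro extensionalityI[of _ I]) (auto simp: PiE_iff)
qed (auto simp: PiE_iff smult_l_distr smult_r_distr smult_assoc1 intro!: restrict_ext)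

section \<open>The dual of an algebra\<close>

locale algebra_dual = R?: ring R + Z: module "scalars C R" Z
  for R :: "('a, 'x) ring_scheme" (structure) and C :: "'a set" and Z :: "('a, 'b, 'y) module_scheme" +
  assumes subring: "subring C R"
    and central: "\<And>c r. c \<in> C \<Longrightarrow> r \<in> carrier R \<Longrightarrow> c \<otimes> r = r \<otimes> c"
begin

abbreviation "D \<equiv> dual R C Z"

section \<open>The dual as a C-module with its two actions of R\<close>

lemma C_carrier: "c \<in> C \<Longrightarrow> c \<in> carrier R"
  using subringE(1)[OF subring] by blast

lemma smult_Z [simp]: "c \<in> C \<Longrightarrow> z \<in> carrier Z \<Longrightarrow> c \<odot>\<^bsub>Z\<^esub> z \<in> carrier Z"
  using Z.smult_closed[of c z] by simp

lemma smult_Z_add: "c \<in> C \<Longrightarrow> y \<in> carrier Z \<Longrightarrow> z \<in> carrier Z \<Longrightarrow>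
    c \<odot>\<^bsub>Z\<^esub> (y \<oplus>\<^bsub>Z\<^esub> z) = c \<odot>\<^bsub>Z\<^esub> y \<oplus>\<^bsub>Z\<^esub> c \<odot>\<^bsub>Z\<^esub> z"
  using Z.smult_r_distr[of c y z] by simp

text \<open>C is commutative. Hence multiplication by c is C-linear and belongs to C', which
  \<open>bidual_scalar\<close> exploits.\<close>

lemma smult_Z_commute: "c \<in> C \<Longrightarrow> d \<in> C \<Longrightarrow> z \<in> carrier Z \<Longrightarrow>
    c \<odot>\<^bsub>Z\<^esub> (d \<odot>\<^bsub>Z\<^esub> z) = d \<odot>\<^bsub>Z\<^esub> (c \<odot>\<^bsub>Z\<^esub> z)"
  using Z.smult_assoc1[of c d z] Z.smult_assoc1[of d c z] central[of c d] C_carrier[of d] by simp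

lemma dual_simps [simp]:
  "\<zero>\<^bsub>D\<^esub> = (\<lambda>x\<in>carrier R. \<zero>\<^bsub>Z\<^esub>)"
  "\<rho> \<oplus>\<^bsub>D\<^esub> \<tau> = (\<lambda>x\<in>carrier R. \<rho> x \<oplus>\<^bsub>Z\<^esub> \<tau> x)"
  "r \<odot>\<^bsub>D\<^esub> \<rho> = ract R \<rho> r"
  by (simp_all add: dual_def)

text \<open>The scalar law has x c as its argument because \<open>right_regular\<close> acts by
  right multiplication.\<close>

lemma dual_iff: "\<rho> \<in> carrier D \<longleftrightarrow> \<rho> \<in> carrier R \<rightarrow>\<^sub>E carrier Z \<and>
    (\<forall>x\<in>carrier R. \<forall>y\<in>carrier R. \<rho> (x \<oplus> y) = \<rho> x \<oplus>\<^bsub>Z\<^esub> \<rho> y) \<and>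
    (\<forall>c\<in>C. \<forall>x\<in>carrier R. \<rho> (x \<otimes> c) = c \<odot>\<^bsub>Z\<^esub> \<rho> x)"
  by (simp add: dual_def mod_hom_def right_regular_def)

lemma dualD:
  assumes "\<rho> \<in> carrier D"
  shows "\<rho> \<in> extensional (carrier R)"
    and "\<And>x. x \<in> carrier R \<Longrightarrow> \<rho> x \<in> carrier Z"
    and "\<And>x y. x \<in> carrier R \<Longrightarrow> y \<in> carrier R \<Longrightarrow> \<rho> (x \<oplus> y) = \<rho> x \<oplus>\<^bsub>Z\<^esub> \<rho> y"
    and "\<And>c x. c \<in> C \<Longrightarrow> x \<in> carrier R \<Longrightarrow> \<rho> (x \<otimes> c) = c \<odot>\<^bsub>Z\<^esub> \<rho> x"
  using assms by (auto simp: dual_iff PiE_iff)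

lemma dual_eqI:
  "\<rho> \<in> carrier D \<Longrightarrow> \<tau> \<in> carrier D \<Longrightarrow> (\<And>x. x \<in> carrier R \<Longrightarrow> \<rho> x = \<tau> x) \<Longrightarrow> \<rho> = \<tau>"
  by (rule extensionalityI) (auto dest: dualD(1))

lemma dualI:
  assumes "\<rho> \<in> carrier R \<rightarrow>\<^sub>E carrier Z"
    and "\<And>x y. x \<in> carrier R \<Longrightarrow> y \<in> carrier R \<Longrightarrow> \<rho> (x \<oplus> y) = \<rho> x \<oplus>\<^bsub>Z\<^esub> \<rho> y"
    and "\<And>c x. c \<in> C \<Longrightarrow> c \<in> carrier R \<Longrightarrow> x \<in> carrier R \<Longrightarrow> \<rho> (x \<otimes> c) = c \<odot>\<^bsub>Z\<^esub> \<rho> x"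
  shows "\<rho> \<in> carrier D"
  using assms C_carrier by (simp add: dual_iff)

lemma lact_apply [simp]: "x \<in> carrier R \<Longrightarrow> lact R r \<rho> x = \<rho> (x \<otimes> r)"
  by (simp add: lact_def)

lemma ract_apply [simp]: "x \<in> carrier R \<Longrightarrow> ract R \<rho> r x = \<rho> (r \<otimes> x)"
  by (simp add: ract_def)

lemma lact_closed [simp]:
  assumes "\<rho> \<in> carrier D" "r \<in> carrier R"
  shows "lact R r \<rho> \<in> carrier D"
proof (rule dualI)
  fix c x assume c: "c \<in> C" "c \<in> carrier R" "x \<in> carrier R"
  \<comment> \<open>Centrality of C makes the left action preserve C-linearity: c has to be moved
    past r.\<close>
  then have "x \<otimes> c \<otimes> r = x \<otimes> r \<otimes> c"
    using assms central[of c r] by (simp add: m_assoc)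
  then show "lact R r \<rho> (x \<otimes> c) = c \<odot>\<^bsub>Z\<^esub> lact R r \<rho> x"
    using assms c by (simp add: dualD(4))
qed (use assms in \<open>auto simp: lact_def l_distr dualD(2,3)\<close>)

lemma ract_closed [simp]:
  assumes "\<rho> \<in> carrier D" "r \<in> carrier R"
  shows "ract R \<rho> r \<in> carrier D"
proof (rule dualI)
  fix c x assume "c \<in> C" "c \<in> carrier R" "x \<in> carrier R"
  then show "ract R \<rho> r (x \<otimes> c) = c \<odot>\<^bsub>Z\<^esub> ract R \<rho> r x"
    using assms by (simp add: dualD(4) flip: m_assoc)
qed (use assms in \<open>auto simp: ract_def r_distr dualD(2,3)\<close>)

lemma ract_one: "\<rho> \<in> carrier D \<Longrightarrow> ract R \<rho> \<one> = \<rho>"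
  by (rule dual_eqI) auto

lemma dual_add_closed: "\<rho> \<in> carrier D \<Longrightarrow> \<tau> \<in> carrier D \<Longrightarrow> \<rho> \<oplus>\<^bsub>D\<^esub> \<tau> \<in> carrier D"
  by (rule dualI) (auto simp: dualD Z.M.a_ac smult_Z_add C_carrier)

lemma dual_module: "module (scalars C R) D"
proof (rule moduleI)
  show "cring (scalars C R)" ..
  show "abelian_group D"
  proof (rule abelian_groupI)
    fix \<rho> \<tau> assume "\<rho> \<in> carrier D" "\<tau> \<in> carrier D"
    then show "\<rho> \<oplus>\<^bsub>D\<^esub> \<tau> \<in> carrier D" by (rule dual_add_closed)
  next
    show "\<zero>\<^bsub>D\<^esub> \<in> carrier D"
      unfolding dual_iff using C_carrier Z.smult_r_null by auto
  next
    fix \<rho> assume \<rho>: "\<rho> \<in> carrier D"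
    have "(\<lambda>x\<in>carrier R. \<ominus>\<^bsub>Z\<^esub> \<rho> x) \<in> carrier D"
      using \<rho> Z.smult_r_minus by (intro dualI) (auto simp: dualD Z.M.minus_add)
    then show "\<exists>\<tau>\<in>carrier D. \<tau> \<oplus>\<^bsub>D\<^esub> \<rho> = \<zero>\<^bsub>D\<^esub>"
      by (rule bexI[rotated]) (auto simp: dualD[OF \<rho>] Z.M.l_neg)
    show "\<zero>\<^bsub>D\<^esub> \<oplus>\<^bsub>D\<^esub> \<rho> = \<rho>"
      using dualD(1)[OF \<rho>] by (intro extensionalityI[of _ "carrier R"]) (auto simp: dualD[OF \<rho>])
  qed (auto simp: dualD Z.M.a_ac intro!: restrict_ext)
next
  fix c \<rho> assume "c \<in> carrier (scalars C R)" "\<rho> \<in> carrier D"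
  then show "c \<odot>\<^bsub>D\<^esub> \<rho> \<in> carrier D" by (simp add: C_carrier)
next
  fix c d \<rho> assume "c \<in> carrier (scalars C R)" "d \<in> carrier (scalars C R)" and \<rho>: "\<rho> \<in> carrier D"
  then have cd: "c \<in> carrier R" "d \<in> carrier R" "c \<in> C" "d \<in> C" by (simp_all add: C_carrier)
  show "(c \<oplus>\<^bsub>scalars C R\<^esub> d) \<odot>\<^bsub>D\<^esub> \<rho> = c \<odot>\<^bsub>D\<^esub> \<rho> \<oplus>\<^bsub>D\<^esub> d \<odot>\<^bsub>D\<^esub> \<rho>"
    using cd \<rho> by (simp add: ract_def l_distr dualD cong: restrict_cong)
  \<comment> \<open>A right action is written here on the left: the right-hand side multiplies by d
    c, which equals c d as C is commutative.\<close>
  show "(c \<otimes>\<^bsub>scalars C R\<^esub> d) \<odot>\<^bsub>D\<^esub> \<rho> = c \<odot>\<^bsub>D\<^esub> (d \<odot>\<^bsub>D\<^esub> \<rho>)"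
    using cd \<rho> by (simp add: ract_def central[of c d] m_assoc cong: restrict_cong)
next
  fix c \<rho> \<tau> assume "c \<in> carrier (scalars C R)" "\<rho> \<in> carrier D" "\<tau> \<in> carrier D"
  then show "c \<odot>\<^bsub>D\<^esub> (\<rho> \<oplus>\<^bsub>D\<^esub> \<tau>) = c \<odot>\<^bsub>D\<^esub> \<rho> \<oplus>\<^bsub>D\<^esub> c \<odot>\<^bsub>D\<^esub> \<tau>"
    by (simp add: ract_def C_carrier cong: restrict_cong)
next
  fix \<rho> assume "\<rho> \<in> carrier D"
  then show "\<one>\<^bsub>scalars C R\<^esub> \<odot>\<^bsub>D\<^esub> \<rho> = \<rho>"
    by (simp add: ract_one)
qed

section \<open>Functionals on the dual and the multiplications they define\<close>

lemma full_bidualD: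
  assumes "t \<in> full_bidual R C Z"
  shows "\<And>\<rho>. \<rho> \<in> carrier D \<Longrightarrow> t \<rho> \<in> carrier Z"
    and "\<And>\<rho> \<tau>. \<rho> \<in> carrier D \<Longrightarrow> \<tau> \<in> carrier D \<Longrightarrow> t (\<rho> \<oplus>\<^bsub>D\<^esub> \<tau>) = t \<rho> \<oplus>\<^bsub>Z\<^esub> t \<tau>"
    and "\<And>c \<rho>. c \<in> C \<Longrightarrow> \<rho> \<in> carrier D \<Longrightarrow> t (ract R \<rho> c) = c \<odot>\<^bsub>Z\<^esub> t \<rho>"
  using mod_homD(2-4)[OF assms[unfolded full_bidual_def]] by (simp_all del: dual_simps(1,2))

lemma bidualD:
  assumes "s \<in> bidual R C Z"
  shows "\<And>\<rho>. \<rho> \<in> carrier D \<Longrightarrow> s \<rho> \<in> carrier Z"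
    and "\<And>\<rho> \<tau>. \<rho> \<in> carrier D \<Longrightarrow> \<tau> \<in> carrier D \<Longrightarrow> s (\<rho> \<oplus>\<^bsub>D\<^esub> \<tau>) = s \<rho> \<oplus>\<^bsub>Z\<^esub> s \<tau>"
    and "\<And>t \<rho>. t \<in> mod_hom (scalars C R) Z Z \<Longrightarrow> \<rho> \<in> carrier D \<Longrightarrow>
      s (compose (carrier R) t \<rho>) = t (s \<rho>)"
  using assms by (auto simp: bidual_def PiE_iff simp del: dual_simps)

text \<open>Multiplication by c is an element of C', and composing it with \<rho> gives \<rho> c. So
  the C'-linear functionals are among the C-linear ones.\<close>

lemma bidual_scalar:
  assumes s: "s \<in> bidual R C Z" and c: "c \<in> C" and \<rho>: "\<rho> \<in> carrier D"
  shows "s (ract R \<rho> c) = c \<odot>\<^bsub>Z\<^esub> s \<rho>"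
proof -
  have "(\<lambda>z\<in>carrier Z. c \<odot>\<^bsub>Z\<^esub> z) \<in> mod_hom (scalars C R) Z Z"
    by (rule mod_homI) (auto simp: c smult_Z_add smult_Z_commute)
  moreover have "ract R \<rho> c = compose (carrier R) (\<lambda>z\<in>carrier Z. c \<odot>\<^bsub>Z\<^esub> z) \<rho>"
    using c \<rho> by (auto simp: ract_def compose_def central dualD)
  ultimately show ?thesis
    using bidualD(3)[OF s _ \<rho>] bidualD(1)[OF s \<rho>] by (metis restrict_apply')
qed

lemma lmult_apply [simp]: "x \<in> carrier R \<Longrightarrow> lmult R t \<rho> x = t (ract R \<rho> x)"
  by (simp add: lmult_def)

lemma rmult_apply [simp]: "x \<in> carrier R \<Longrightarrow> rmult R \<rho> s x = s (lact R x \<rho>)"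
  by (simp add: rmult_def)

lemma ract_add: "\<rho> \<in> carrier D \<Longrightarrow> x \<in> carrier R \<Longrightarrow> y \<in> carrier R \<Longrightarrow>
    ract R \<rho> (x \<oplus> y) = ract R \<rho> x \<oplus>\<^bsub>D\<^esub> ract R \<rho> y"
  by (auto simp: ract_def l_distr dualD)

lemma add_ract: "\<rho> \<in> carrier D \<Longrightarrow> \<tau> \<in> carrier D \<Longrightarrow> x \<in> carrier R \<Longrightarrow>
    ract R (\<rho> \<oplus>\<^bsub>D\<^esub> \<tau>) x = ract R \<rho> x \<oplus>\<^bsub>D\<^esub> ract R \<tau> x"
  by (auto simp: ract_def)

lemma ract_ract: "x \<in> carrier R \<Longrightarrow> y \<in> carrier R \<Longrightarrow>
    ract R (ract R \<rho> x) y = ract R \<rho> (x \<otimes> y)"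
  by (auto simp: ract_def m_assoc)

lemma lact_add: "\<rho> \<in> carrier D \<Longrightarrow> x \<in> carrier R \<Longrightarrow> y \<in> carrier R \<Longrightarrow>
    lact R (x \<oplus> y) \<rho> = lact R x \<rho> \<oplus>\<^bsub>D\<^esub> lact R y \<rho>"
  by (auto simp: lact_def r_distr dualD)

lemma add_lact: "\<rho> \<in> carrier D \<Longrightarrow> \<tau> \<in> carrier D \<Longrightarrow> x \<in> carrier R \<Longrightarrow>
    lact R x (\<rho> \<oplus>\<^bsub>D\<^esub> \<tau>) = lact R x \<rho> \<oplus>\<^bsub>D\<^esub> lact R x \<tau>"
  by (auto simp: lact_def)

lemma lact_ract: "x \<in> carrier R \<Longrightarrow> y \<in> carrier R \<Longrightarrow>
    lact R x (ract R \<rho> y) = ract R (lact R x \<rho>) y"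
  by (auto simp: ract_def lact_def m_assoc)

lemma lact_scalar:
  assumes "c \<in> C" "x \<in> carrier R"
  shows "lact R (x \<otimes> c) \<rho> = ract R (lact R x \<rho>) c"
  using assms central[of c] by (auto simp: ract_def lact_def C_carrier m_assoc)

lemma lact_one: "\<rho> \<in> carrier D \<Longrightarrow> lact R \<one> \<rho> = \<rho>"
  by (rule dual_eqI) auto

lemma lmult_closed [simp]:
  assumes "t \<in> full_bidual R C Z" "\<rho> \<in> carrier D"
  shows "lmult R t \<rho> \<in> carrier D"
proof (rule dualI)
  fix x y assume "x \<in> carrier R" "y \<in> carrier R"
  then show "lmult R t \<rho> (x \<oplus> y) = lmult R t \<rho> x \<oplus>\<^bsub>Z\<^esub> lmult R t \<rho> y"
    using assms full_bidualD(2)[of t "ract R \<rho> x" "ract R \<rho> y"] by (simp add: ract_add del: dual_simps)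
next
  fix c x assume "c \<in> C" "c \<in> carrier R" "x \<in> carrier R"
  then show "lmult R t \<rho> (x \<otimes> c) = c \<odot>\<^bsub>Z\<^esub> lmult R t \<rho> x"
    using assms full_bidualD(3)[of t c "ract R \<rho> x"] by (simp add: ract_ract)
qed (use assms full_bidualD(1) in \<open>simp add: lmult_def\<close>)

lemma rmult_closed [simp]:
  assumes "s \<in> bidual R C Z" "\<rho> \<in> carrier D"
  shows "rmult R \<rho> s \<in> carrier D"
proof (rule dualI)
  fix x y assume "x \<in> carrier R" "y \<in> carrier R"
  then show "rmult R \<rho> s (x \<oplus> y) = rmult R \<rho> s x \<oplus>\<^bsub>Z\<^esub> rmult R \<rho> s y"
    using assms bidualD(2)[of s "lact R x \<rho>" "lact R y \<rho>"] by (simp add: lact_add del: dual_simps)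
next
  fix c x assume "c \<in> C" "c \<in> carrier R" "x \<in> carrier R"
  then show "rmult R \<rho> s (x \<otimes> c) = c \<odot>\<^bsub>Z\<^esub> rmult R \<rho> s x"
    using assms by (simp add: lact_scalar bidual_scalar)
qed (use assms bidualD(1) in \<open>simp add: rmult_def\<close>)

section \<open>Endomorphisms of the dual as left multiplications\<close>

lemma End_eq_left_mult: "mod_hom R D D = left_mult_map R C Z ` full_bidual R C Z"
proof (intro equalityI subsetI)
  fix f assume f: "f \<in> mod_hom R D D"
  note f' = mod_homD[OF f]
  define t where "t = (\<lambda>\<rho>\<in>carrier D. f \<rho> \<one>)"
  have t: "t \<in> full_bidual R C Z"
    unfolding full_bidual_def
  proof (rule mod_homI)
    show "t \<in> carrier D \<rightarrow>\<^sub>E carrier Z"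
      using f'(2) dualD(2) by (simp add: t_def)
  next
    fix c \<rho> assume "c \<in> carrier (scalars C R)" and \<rho>: "\<rho> \<in> carrier D"
    then have c: "c \<in> C" "c \<in> carrier R" by (simp_all add: C_carrier)
    \<comment> \<open>By R-linearity, t (\<rho> c) is the value of f \<rho> at c; writing c as one
      times c lets C-linearity of f \<rho> pull the scalar out.\<close>
    then have "f \<rho> (\<one> \<otimes> c) = c \<odot>\<^bsub>Z\<^esub> f \<rho> \<one>"
      using dualD(4)[OF f'(2)[OF \<rho>]] by blast
    then show "t (c \<odot>\<^bsub>D\<^esub> \<rho>) = c \<odot>\<^bsub>Z\<^esub> t \<rho>"
      using \<rho> c f'(4)[of c \<rho>] by (simp add: t_def)
  next
    fix \<rho> \<tau> assume "\<rho> \<in> carrier D" "\<tau> \<in> carrier D"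
    then show "t (\<rho> \<oplus>\<^bsub>D\<^esub> \<tau>) = t \<rho> \<oplus>\<^bsub>Z\<^esub> t \<tau>"
      using dual_add_closed[of \<rho> \<tau>] f'(3)[of \<rho> \<tau>] by (simp add: t_def)
  qed
  moreover have "f = left_mult_map R C Z t"
  proof (rule extensionalityI[of _ "carrier D"])
    fix \<rho> assume \<rho>: "\<rho> \<in> carrier D"
    have "f \<rho> = lmult R t \<rho>"
      using \<rho> t f'(4)[OF _ \<rho>] by (intro dual_eqI) (simp_all add: t_def f'(2))
    then show "f \<rho> = left_mult_map R C Z t \<rho>"
      using \<rho> by (simp add: left_mult_map_def)
  qed (use f'(1) in \<open>auto simp: left_mult_map_def PiE_def\<close>)
  ultimately show "f \<in> left_mult_map R C Z ` full_bidual R C Z" by blast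
next
  fix f assume "f \<in> left_mult_map R C Z ` full_bidual R C Z"
  then obtain t where t: "t \<in> full_bidual R C Z" and f: "f = left_mult_map R C Z t" by blast
  show "f \<in> mod_hom R D D"
  proof (rule mod_homI)
    show "f \<in> carrier D \<rightarrow>\<^sub>E carrier D" using t by (simp add: f left_mult_map_def)
  next
    fix \<rho> \<tau> assume \<rho>\<tau>: "\<rho> \<in> carrier D" "\<tau> \<in> carrier D"
    have "lmult R t (\<rho> \<oplus>\<^bsub>D\<^esub> \<tau>) = lmult R t \<rho> \<oplus>\<^bsub>D\<^esub> lmult R t \<tau>"
    proof (rule dual_eqI)
      fix x assume "x \<in> carrier R"
      then show "lmult R t (\<rho> \<oplus>\<^bsub>D\<^esub> \<tau>) x = (lmult R t \<rho> \<oplus>\<^bsub>D\<^esub> lmult R t \<tau>) x"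
        using t \<rho>\<tau> add_ract[of \<rho> \<tau> x] full_bidualD(2)[OF t, of "ract R \<rho> x" "ract R \<tau> x"]
        by simp
    qed (use t \<rho>\<tau> dual_add_closed in \<open>simp_all del: dual_simps\<close>)
    then show "f (\<rho> \<oplus>\<^bsub>D\<^esub> \<tau>) = f \<rho> \<oplus>\<^bsub>D\<^esub> f \<tau>"
      using \<rho>\<tau> dual_add_closed by (simp add: f left_mult_map_def del: dual_simps)
  next
    fix r \<rho> assume "r \<in> carrier R" "\<rho> \<in> carrier D"
    \<comment> \<open>Both sides send x to t (\<rho> (r x)), where r x acts on \<rho> from the
      right.\<close>
    moreover from this t have "lmult R t (ract R \<rho> r) = ract R (lmult R t \<rho>) r"
      by (intro dual_eqI) (simp_all add: ract_ract)
    ultimately show "f (r \<odot>\<^bsub>D\<^esub> \<rho>) = r \<odot>\<^bsub>D\<^esub> f \<rho>"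
      using t by (simp add: f left_mult_map_def)
  qed
qed

section \<open>Biendomorphisms of the dual as right multiplications\<close>

lemma dual_zero: "\<rho> \<in> carrier D \<Longrightarrow> \<rho> \<zero> = \<zero>\<^bsub>Z\<^esub>"
  by (rule additive_zero) (auto simp: dualD abelian_group_axioms Z.M.abelian_group_axioms)

lemma additive_functional_zero:
  assumes "\<And>\<rho>. \<rho> \<in> carrier D \<Longrightarrow> s \<rho> \<in> carrier Z"
    and "\<And>\<rho> \<tau>. \<rho> \<in> carrier D \<Longrightarrow> \<tau> \<in> carrier D \<Longrightarrow> s (\<rho> \<oplus>\<^bsub>D\<^esub> \<tau>) = s \<rho> \<oplus>\<^bsub>Z\<^esub> s \<tau>"
  shows "s \<zero>\<^bsub>D\<^esub> = \<zero>\<^bsub>Z\<^esub>"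
  by (rule additive_zero[OF module.axioms(2)[OF dual_module] Z.M.abelian_group_axioms]) (fact assms)+

text \<open>The two actions of R on the dual commute. These endomorphisms are the test maps that
  determine a biendomorphism from its values at one.\<close>

lemma lact_map_End:
  assumes "r \<in> carrier R"
  shows "(\<lambda>\<rho>\<in>carrier D. lact R r \<rho>) \<in> mod_hom R D D"
proof (rule mod_homI)
  fix \<rho> \<tau> assume "\<rho> \<in> carrier D" "\<tau> \<in> carrier D"
  then show "(\<lambda>\<rho>\<in>carrier D. lact R r \<rho>) (\<rho> \<oplus>\<^bsub>D\<^esub> \<tau>)
      = (\<lambda>\<rho>\<in>carrier D. lact R r \<rho>) \<rho> \<oplus>\<^bsub>D\<^esub> (\<lambda>\<rho>\<in>carrier D. lact R r \<rho>) \<tau>"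
    using assms add_lact[of \<rho> \<tau> r] dual_add_closed[of \<rho> \<tau>] by (simp del: dual_simps)
next
  fix k \<rho> assume "k \<in> carrier R" "\<rho> \<in> carrier D"
  then show "(\<lambda>\<rho>\<in>carrier D. lact R r \<rho>) (k \<odot>\<^bsub>D\<^esub> \<rho>) = k \<odot>\<^bsub>D\<^esub> (\<lambda>\<rho>\<in>carrier D. lact R r \<rho>) \<rho>"
    using assms by (simp add: lact_ract)
qed (use assms in simp)

lemma compose_closed:
  assumes "u \<in> mod_hom (scalars C R) Z Z" "\<rho> \<in> carrier D"
  shows "compose (carrier R) u \<rho> \<in> carrier D"
  using assms mod_homD(2-4)[OF assms(1)]
  by (intro dualI) (simp_all add: compose_def dualD)

text \<open>Composition with u changes values while the action of R changes arguments, so the two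
  commute. Commuting with these maps is what makes the functional of a biendomorphism C'-linear,
  hence an element of the bidual.\<close>

lemma compose_map_End:
  assumes u: "u \<in> mod_hom (scalars C R) Z Z"
  shows "(\<lambda>\<rho>\<in>carrier D. compose (carrier R) u \<rho>) \<in> mod_hom R D D"
proof (rule mod_homI)
  show "(\<lambda>\<rho>\<in>carrier D. compose (carrier R) u \<rho>) \<in> carrier D \<rightarrow>\<^sub>E carrier D"
    using compose_closed[OF u] by simp
next
  fix \<rho> \<tau> assume \<rho>\<tau>: "\<rho> \<in> carrier D" "\<tau> \<in> carrier D"
  then have "compose (carrier R) u (\<rho> \<oplus>\<^bsub>D\<^esub> \<tau>) = compose (carrier R) u \<rho> \<oplus>\<^bsub>D\<^esub> compose (carrier R) u \<tau>"
    by (simp add: compose_def dualD mod_homD(3)[OF u] cong: restrict_cong)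
  then show "(\<lambda>\<rho>\<in>carrier D. compose (carrier R) u \<rho>) (\<rho> \<oplus>\<^bsub>D\<^esub> \<tau>)
      = (\<lambda>\<rho>\<in>carrier D. compose (carrier R) u \<rho>) \<rho> \<oplus>\<^bsub>D\<^esub> (\<lambda>\<rho>\<in>carrier D. compose (carrier R) u \<rho>) \<tau>"
    using \<rho>\<tau> dual_add_closed[of \<rho> \<tau>] by (simp del: dual_simps)
next
  fix k \<rho> assume k: "k \<in> carrier R" "\<rho> \<in> carrier D"
  then have "compose (carrier R) u (ract R \<rho> k) = ract R (compose (carrier R) u \<rho>) k"
    by (simp add: compose_def ract_def cong: restrict_cong)
  then show "(\<lambda>\<rho>\<in>carrier D. compose (carrier R) u \<rho>) (k \<odot>\<^bsub>D\<^esub> \<rho>)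
      = k \<odot>\<^bsub>D\<^esub> (\<lambda>\<rho>\<in>carrier D. compose (carrier R) u \<rho>) \<rho>"
    using k by simp
qed

text \<open>Pointwise form of the equality of the two Arens products of s with every t. Here t
  ranges over all C-linear functionals, since these give all endomorphisms of
  \<open>D\<close>.\<close>

definition commuting :: "(('a \<Rightarrow> 'b) \<Rightarrow> 'b) \<Rightarrow> bool" where
  "commuting s \<longleftrightarrow> (\<forall>t\<in>full_bidual R C Z. \<forall>\<rho>\<in>carrier D. s (lmult R t \<rho>) = t (rmult R \<rho> s))"

lemma arens_eq_iff_commuting:
  "(\<forall>t\<in>full_bidual R C Z. arens_dot R C Z s t = arens_diamond R C Z s t) \<longleftrightarrow> commuting s"
proof -
  have "arens_dot R C Z s t = arens_diamond R C Z s t \<longleftrightarrow>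
      (\<forall>\<rho>\<in>carrier D. s (lmult R t \<rho>) = t (rmult R \<rho> s))" for t
    unfolding arens_dot_def arens_diamond_def restrict_eq_iff ..
  then show ?thesis by (simp add: commuting_def)
qed

lemma biend_is_right_mult:
  assumes "b \<in> biend R D"
  shows "\<exists>s\<in>bidual R C Z. commuting s \<and> b = right_mult_map R C Z s"
proof -
  have b: "b \<in> carrier D \<rightarrow>\<^sub>E carrier D" "\<And>\<rho>. \<rho> \<in> carrier D \<Longrightarrow> b \<rho> \<in> carrier D"
    and b_add: "\<And>\<rho> \<tau>. \<rho> \<in> carrier D \<Longrightarrow> \<tau> \<in> carrier D \<Longrightarrow> b (\<rho> \<oplus>\<^bsub>D\<^esub> \<tau>) = b \<rho> \<oplus>\<^bsub>D\<^esub> b \<tau>"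
    and b_End: "\<And>f \<rho>. f \<in> mod_hom R D D \<Longrightarrow> \<rho> \<in> carrier D \<Longrightarrow> b (f \<rho>) = f (b \<rho>)"
    using assms by (auto simp: biend_def PiE_iff simp del: dual_simps)
  define s where "s = (\<lambda>\<rho>\<in>carrier D. b \<rho> \<one>)"
  have s_rmult: "rmult R \<rho> s = b \<rho>" if \<rho>: "\<rho> \<in> carrier D" for \<rho>
  proof (rule extensionalityI[of _ "carrier R"])
    fix r assume r: "r \<in> carrier R"
    \<comment> \<open>As b commutes with the left action of r, the value of b (r \<rho>) at one is
      that of r (b \<rho>) at one, which is b \<rho> at r.\<close>
    then show "rmult R \<rho> s r = b \<rho> r"
      using \<rho> b_End[OF lact_map_End[OF r] \<rho>] by (simp add: s_def b)
  qed (use dualD(1)[OF b(2)[OF \<rho>]] in \<open>simp_all add: rmult_def\<close>)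
  have s: "s \<in> bidual R C Z"
    unfolding bidual_def
  proof (intro CollectI conjI ballI)
    show "s \<in> carrier D \<rightarrow>\<^sub>E carrier Z" using b(2) dualD(2) by (simp add: s_def)
  next
    fix \<rho> \<tau> assume "\<rho> \<in> carrier D" "\<tau> \<in> carrier D"
    then show "s (\<rho> \<oplus>\<^bsub>D\<^esub> \<tau>) = s \<rho> \<oplus>\<^bsub>Z\<^esub> s \<tau>"
      using dual_add_closed[of \<rho> \<tau>] b_add[of \<rho> \<tau>] by (simp add: s_def)
  next
    fix u \<rho> assume u: "u \<in> mod_hom (scalars C R) Z Z" and \<rho>: "\<rho> \<in> carrier D"
    then have "b (compose (carrier R) u \<rho>) = compose (carrier R) u (b \<rho>)"
      using b_End[OF compose_map_End[OF u] \<rho>] b(2) by simp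
    then show "s (compose (carrier R) u \<rho>) = u (s \<rho>)"
      using compose_closed[OF u \<rho>] \<rho> by (simp add: s_def compose_def)
  qed
  moreover have "commuting s"
    unfolding commuting_def
  proof (intro ballI)
    fix t \<rho> assume t: "t \<in> full_bidual R C Z" and \<rho>: "\<rho> \<in> carrier D"
    then have "left_mult_map R C Z t \<in> mod_hom R D D" by (simp add: End_eq_left_mult)
    \<comment> \<open>Evaluated at one, this identity is the required equation, since s reads off b
      at one.\<close>
    then have "b (lmult R t \<rho>) = lmult R t (b \<rho>)"
      using b_End[OF _ \<rho>] b(2)[OF \<rho>] \<rho> by (force simp: left_mult_map_def)
    then show "s (lmult R t \<rho>) = t (rmult R \<rho> s)"
      using t \<rho> b(2)[OF \<rho>] by (simp add: s_rmult) (simp add: s_def ract_one)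
  qed
  moreover have "b = right_mult_map R C Z s"
    using b(1) by (intro extensionalityI[of _ "carrier D"]) (auto simp: PiE_iff right_mult_map_def s_rmult)
  ultimately show ?thesis by blast
qed

text \<open>Right multiplication by \<open>s\<close> commutes with \<open>t\<close> at the argument \<open>r\<close> because \<open>s\<close> commutes with
  \<open>t' = (\<tau> \<mapsto> t (\<tau> r))\<close>, where \<open>r (t \<rho>) = t' \<rho>\<close>.\<close>

lemma right_mult_biend:
  assumes s: "s \<in> bidual R C Z" and comm: "commuting s"
  shows "right_mult_map R C Z s \<in> biend R D"
  unfolding biend_def
proof (intro CollectI conjI ballI)
  show "right_mult_map R C Z s \<in> carrier D \<rightarrow>\<^sub>E carrier D"
    using s by (simp add: right_mult_map_def)
next
  fix \<rho> \<tau> assume \<rho>\<tau>: "\<rho> \<in> carrier D" "\<tau> \<in> carrier D"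
  have "rmult R (\<rho> \<oplus>\<^bsub>D\<^esub> \<tau>) s = rmult R \<rho> s \<oplus>\<^bsub>D\<^esub> rmult R \<tau> s"
  proof (rule dual_eqI)
    fix x assume "x \<in> carrier R"
    then show "rmult R (\<rho> \<oplus>\<^bsub>D\<^esub> \<tau>) s x = (rmult R \<rho> s \<oplus>\<^bsub>D\<^esub> rmult R \<tau> s) x"
      using \<rho>\<tau> add_lact[of \<rho> \<tau> x] bidualD(2)[OF s, of "lact R x \<rho>" "lact R x \<tau>"] by simp
  qed (use s \<rho>\<tau> dual_add_closed in \<open>simp_all del: dual_simps\<close>)
  then show "right_mult_map R C Z s (\<rho> \<oplus>\<^bsub>D\<^esub> \<tau>) = right_mult_map R C Z s \<rho> \<oplus>\<^bsub>D\<^esub> right_mult_map R C Z s \<tau>"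
    using \<rho>\<tau> dual_add_closed by (simp add: right_mult_map_def del: dual_simps)
next
  fix f \<rho> assume "f \<in> mod_hom R D D" and \<rho>: "\<rho> \<in> carrier D"
  then obtain t where t: "t \<in> full_bidual R C Z" and f: "f = left_mult_map R C Z t"
    by (auto simp: End_eq_left_mult)
  have "rmult R (lmult R t \<rho>) s = lmult R t (rmult R \<rho> s)"
  proof (rule dual_eqI)
    fix r assume r: "r \<in> carrier R"
    define t' where "t' = (\<lambda>\<tau>\<in>carrier D. t (ract R \<tau> r))"
    have "t' \<in> full_bidual R C Z"
      unfolding full_bidual_def
    proof (rule mod_homI)
      show "t' \<in> carrier D \<rightarrow>\<^sub>E carrier Z" using r full_bidualD(1)[OF t] by (simp add: t'_def)
    next
      fix \<tau> \<tau>' assume "\<tau> \<in> carrier D" "\<tau>' \<in> carrier D"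
      then show "t' (\<tau> \<oplus>\<^bsub>D\<^esub> \<tau>') = t' \<tau> \<oplus>\<^bsub>Z\<^esub> t' \<tau>'"
        using r dual_add_closed[of \<tau> \<tau>'] add_ract[of \<tau> \<tau>' r] full_bidualD(2)[OF t]
        by (simp add: t'_def del: dual_simps)
    next
      fix c \<tau> assume "c \<in> carrier (scalars C R)" and \<tau>: "\<tau> \<in> carrier D"
      then have c: "c \<in> C" "c \<in> carrier R" by (simp_all add: C_carrier)
      \<comment> \<open>C-linearity of t' rests on c commuting with r.\<close>
      then have "ract R (ract R \<tau> c) r = ract R (ract R \<tau> r) c"
        using r by (simp add: ract_ract central[of c r])
      then show "t' (c \<odot>\<^bsub>D\<^esub> \<tau>) = c \<odot>\<^bsub>Z\<^esub> t' \<tau>"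
        using r c \<tau> full_bidualD(3)[OF t, of c "ract R \<tau> r"] by (simp add: t'_def)
    qed
    then have "s (lmult R t' \<rho>) = t' (rmult R \<rho> s)"
      using comm \<rho> by (simp add: commuting_def)
    moreover have "lact R r (lmult R t \<rho>) = lmult R t' \<rho>"
      using r \<rho> by (auto simp: lact_def lmult_def t'_def ract_ract)
    ultimately show "rmult R (lmult R t \<rho>) s r = lmult R t (rmult R \<rho> s) r"
      using r s \<rho> by (simp add: t'_def)
  qed (use s t \<rho> in simp_all)
  then show "right_mult_map R C Z s (f \<rho>) = f (right_mult_map R C Z s \<rho>)"
    using s t \<rho> by (simp add: f right_mult_map_def left_mult_map_def)
qed

lemma biend_eq: "biend R D = right_mult_map R C Z ` {s \<in> bidual R C Z. commuting s}"
  using biend_is_right_mult right_mult_biend by blast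

section \<open>Interpolation on finite sets of functionals\<close>

lemma interpolating_imp_commuting:
  assumes s: "s \<in> bidual R C Z"
    and interp: "\<And>F. F \<subseteq> carrier D \<Longrightarrow> finite F \<Longrightarrow> \<exists>r\<in>carrier R. \<forall>\<rho>\<in>F. rmult R \<rho> s = ract R \<rho> r"
  shows "commuting s"
  unfolding commuting_def
proof (intro ballI)
  fix t \<rho> assume t: "t \<in> full_bidual R C Z" and \<rho>: "\<rho> \<in> carrier D"
  \<comment> \<open>One r must serve both \<rho> and t \<rho>: then s (t \<rho>) is the value of (t
    \<rho>) r at one, which is t (\<rho> r), and this is t (\<rho> s).\<close>
  then obtain r where r: "r \<in> carrier R" "rmult R \<rho> s = ract R \<rho> r"
      "rmult R (lmult R t \<rho>) s = ract R (lmult R t \<rho>) r"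
    using interp[of "{\<rho>, lmult R t \<rho>}"] by auto
  have "s (lmult R t \<rho>) = rmult R (lmult R t \<rho>) s \<one>"
    using t \<rho> by (simp add: lact_one)
  also have "\<dots> = t (rmult R \<rho> s)"
    unfolding r(3) using r(1,2) by simp
  finally show "s (lmult R t \<rho>) = t (rmult R \<rho> s)" .
qed

lemma right_mult_by_biend:
  assumes r: "r \<in> carrier R"
  shows "right_mult_by R C Z r \<in> biend R D"
  unfolding biend_def
proof (intro CollectI conjI ballI)
  fix \<rho> \<tau> assume "\<rho> \<in> carrier D" "\<tau> \<in> carrier D"
  then show "right_mult_by R C Z r (\<rho> \<oplus>\<^bsub>D\<^esub> \<tau>) = right_mult_by R C Z r \<rho> \<oplus>\<^bsub>D\<^esub> right_mult_by R C Z r \<tau>"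
    using r add_ract dual_add_closed by (simp add: right_mult_by_def del: dual_simps)
next
  fix f \<rho> assume f: "f \<in> mod_hom R D D" and \<rho>: "\<rho> \<in> carrier D"
  then show "right_mult_by R C Z r (f \<rho>) = f (right_mult_by R C Z r \<rho>)"
    using r mod_homD(2)[OF f] mod_homD(4)[OF f r \<rho>] by (simp add: right_mult_by_def)
qed (use r in \<open>simp add: right_mult_by_def\<close>)

lemma commuting_imp_interpolating:
  assumes cog: "cogenerator TYPE(('a, 'b) test) (scalars C R) Z"
    and s: "s \<in> bidual R C Z" and comm: "commuting s"
    and F: "F \<subseteq> carrier D" "finite F"
  shows "\<exists>r\<in>carrier R. \<forall>\<rho>\<in>F. rmult R \<rho> s = ract R \<rho> r"
proof -
  \<comment> \<open>The members of F are numbered from 0, possibly with repetitions, because the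
    functions in \<open>test\<close> are indexed by \<open>nat\<close>; n may be 0.\<close>
  obtain n :: nat and \<eta> where F_eq: "F = \<eta> ` {i. i < n}"
    using F(2) unfolding finite_conv_nat_seg_image by blast
  then have \<eta>: "\<And>i. i < n \<Longrightarrow> \<eta> i \<in> carrier D" using F(1) by blast
  define I where "I = {..<n}"
  define P where "P = power_module I D"
  \<comment> \<open>\<open>v r\<close> and \<open>w\<close> are the tuples of all \<rho> r and of
    all \<rho> s for \<rho> in F; the claim is that w equals some \<open>v r\<close>.\<close>
  define v where "v r = (\<lambda>i\<in>I. ract R (\<eta> i) r)" for r
  define w where "w = (\<lambda>i\<in>I. rmult R (\<eta> i) s)"
  have I: "i \<in> I \<longleftrightarrow> i < n" for i by (simp add: I_def)
  interpret D: module "scalars C R" D by (rule dual_module)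
  have P_module: "module (scalars C R) P" unfolding P_def by (rule D.power_module)
  interpret P: module "scalars C R" P by (rule P_module)
  have P: "carrier P = I \<rightarrow>\<^sub>E carrier D" "\<zero>\<^bsub>P\<^esub> = (\<lambda>i\<in>I. \<zero>\<^bsub>D\<^esub>)"
    "\<And>v w. v \<oplus>\<^bsub>P\<^esub> w = (\<lambda>i\<in>I. v i \<oplus>\<^bsub>D\<^esub> w i)" "\<And>a v. a \<odot>\<^bsub>P\<^esub> v = (\<lambda>i\<in>I. a \<odot>\<^bsub>D\<^esub> v i)"
    by (simp_all only: P_def power_module_simps)
  \<comment> \<open>The operations of \<open>D\<close> stay folded from here on, so that the laws of
    abstract modules match.\<close>
  note dual_simps [simp del]
  have v_closed: "v r \<in> carrier P" if "r \<in> carrier R" for r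
    using that \<eta> by (simp add: v_def P I)
  have w_closed: "w \<in> carrier P"
    using s \<eta> by (simp add: w_def P I)
  have v_add: "v (x \<oplus> y) = v x \<oplus>\<^bsub>P\<^esub> v y" if "x \<in> carrier R" "y \<in> carrier R" for x y
    using that \<eta> by (simp add: v_def P I ract_add cong: restrict_cong)
  have v_zero: "v \<zero> = \<zero>\<^bsub>P\<^esub>"
  proof -
    have "ract R \<rho> \<zero> = \<zero>\<^bsub>D\<^esub>" if "\<rho> \<in> carrier D" for \<rho>
      unfolding dual_simps(1) ract_def by (rule restrict_ext) (simp add: that dual_zero)
    then show ?thesis using \<eta> by (simp add: v_def P I cong: restrict_cong)
  qed
  have N: "submodule (v ` carrier R) (scalars C R) P"
  proof (rule P.submoduleI)
    show "\<zero>\<^bsub>P\<^esub> \<in> v ` carrier R" using v_zero by (metis image_eqI zero_closed)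
  next
    fix a assume "a \<in> v ` carrier R"
    then obtain x where x: "x \<in> carrier R" "a = v x" by blast
    then have "v (\<ominus> x) \<oplus>\<^bsub>P\<^esub> a = \<zero>\<^bsub>P\<^esub>" using v_add[of "\<ominus> x" x] v_zero by (simp add: l_neg)
    then have "\<ominus>\<^bsub>P\<^esub> a = v (\<ominus> x)" using x v_closed by (intro P.minus_equality) simp_all
    then show "\<ominus>\<^bsub>P\<^esub> a \<in> v ` carrier R" using x by simp
  next
    fix c a assume "c \<in> carrier (scalars C R)" "a \<in> v ` carrier R"
    then obtain x where x: "c \<in> C" "c \<in> carrier R" "x \<in> carrier R" "a = v x"
      using C_carrier by auto
    \<comment> \<open>Acting on \<rho> x by c gives \<rho> (x c), so scalars only change the
      parameter of \<open>v\<close>.\<close>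
    then have "c \<odot>\<^bsub>P\<^esub> a = v (x \<otimes> c)"
      by (simp add: v_def P dual_simps(3) ract_ract cong: restrict_cong)
    then show "c \<odot>\<^bsub>P\<^esub> a \<in> v ` carrier R" using x by simp
  qed (use v_closed in \<open>auto simp flip: v_add\<close>)
  have "w \<in> v ` carrier R"
  proof (rule ccontr)
    assume "w \<notin> v ` carrier R"
    \<comment> \<open>Tuples become second components of pairs with a fixed arbitrary first
      component; cosets are then sets of such pairs, of type \<open>test\<close>.\<close>
    moreover have "inj_on (Pair undefined :: _ \<Rightarrow> 'a \<times> (nat \<Rightarrow> 'a \<Rightarrow> 'b)) (carrier P)"
      by (simp add: inj_on_def)
    ultimately obtain f where f: "f \<in> mod_hom (scalars C R) P Z"
        "\<And>r. r \<in> carrier R \<Longrightarrow> f (v r) = \<zero>\<^bsub>Z\<^esub>" "f w \<noteq> \<zero>\<^bsub>Z\<^esub>"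
      using cogenerator_separates_submodule[OF cog P_module N w_closed] by blast
    note f' = mod_homD(2-4)[OF f(1)]
    \<comment> \<open>\<open>single k\<close> is the inclusion of the k-th coordinate, and
      \<open>trunc k\<close> keeps the coordinates below k. With \<open>t k\<close> being f after
      \<open>single k\<close>, the value of f at \<open>trunc k u\<close> is the sum of the
      \<open>t i (u i)\<close> over i < k, for k at most n.\<close>
    define single where "single k \<rho> = (\<lambda>i\<in>I. if i = k then \<rho> else \<zero>\<^bsub>D\<^esub>)" for k :: nat and \<rho>
    define trunc where "trunc k u = (\<lambda>i\<in>I. if i < k then u i else \<zero>\<^bsub>D\<^esub>)" for k :: nat and u
    define t where "t k = (\<lambda>\<rho>\<in>carrier D. f (single k \<rho>))" for k
    have single_closed: "single k \<rho> \<in> carrier P" if "\<rho> \<in> carrier D" for k \<rho>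
      using that by (simp add: single_def P)
    have trunc_closed: "trunc k u \<in> carrier P" if "\<And>i. i < n \<Longrightarrow> u i \<in> carrier D" for k u
      using that by (simp add: trunc_def P I)
    have t: "t k \<in> full_bidual R C Z" for k
      unfolding full_bidual_def
    proof (rule mod_homI)
      show "t k \<in> carrier D \<rightarrow>\<^sub>E carrier Z" using f'(1) single_closed by (simp add: t_def)
    next
      fix \<rho> \<tau> assume "\<rho> \<in> carrier D" "\<tau> \<in> carrier D"
      moreover from this have "single k (\<rho> \<oplus>\<^bsub>D\<^esub> \<tau>) = single k \<rho> \<oplus>\<^bsub>P\<^esub> single k \<tau>"
        by (auto simp: single_def P)
      ultimately show "t k (\<rho> \<oplus>\<^bsub>D\<^esub> \<tau>) = t k \<rho> \<oplus>\<^bsub>Z\<^esub> t k \<tau>"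
        using f'(2) single_closed by (simp add: t_def)
    next
      fix c \<rho> assume "c \<in> carrier (scalars C R)" "\<rho> \<in> carrier D"
      moreover from this have "single k (c \<odot>\<^bsub>D\<^esub> \<rho>) = c \<odot>\<^bsub>P\<^esub> single k \<rho>"
        using D.smult_r_null[of c] by (auto simp: single_def P)
      moreover have "c \<odot>\<^bsub>D\<^esub> \<rho> \<in> carrier D" using calculation(1,2) by (rule D.smult_closed)
      ultimately show "t k (c \<odot>\<^bsub>D\<^esub> \<rho>) = c \<odot>\<^bsub>Z\<^esub> t k \<rho>"
        using f'(3) single_closed by (simp add: t_def)
    qed
    \<comment> \<open>The recursion for these partial sums; k < n ensures that k is a
      coordinate.\<close>
    have f_trunc: "f (trunc (Suc k) u) = f (trunc k u) \<oplus>\<^bsub>Z\<^esub> t k (u k)"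
      if "\<And>i. i < n \<Longrightarrow> u i \<in> carrier D" "k < n" for k u
    proof -
      have "trunc (Suc k) u = trunc k u \<oplus>\<^bsub>P\<^esub> single k (u k)"
        unfolding trunc_def single_def P
        by (rule restrict_ext) (use that in \<open>auto simp: I less_Suc_eq\<close>)
      then show ?thesis
        using that f'(2) trunc_closed single_closed by (simp add: t_def)
    qed
    \<comment> \<open>The sum of the left multiples of \<open>\<eta> i\<close> by \<open>t i\<close>
      over i < k, written as a function of r.\<close>
    define g where "g k = (\<lambda>r\<in>carrier R. f (trunc k (\<lambda>i. ract R (\<eta> i) r)))" for k
    have f_zero: "f \<zero>\<^bsub>P\<^esub> = \<zero>\<^bsub>Z\<^esub>"
      by (rule additive_zero[OF P.M.abelian_group_axioms Z.M.abelian_group_axioms]) (fact f')+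
    have s_zero: "s \<zero>\<^bsub>D\<^esub> = \<zero>\<^bsub>Z\<^esub>"
      using bidualD(1,2)[OF s] by (rule additive_functional_zero)
    have trunc_0: "trunc 0 u = \<zero>\<^bsub>P\<^esub>" for u
      by (simp add: trunc_def P)
    \<comment> \<open>Induction moves s through the partial sums: additivity of s splits off one
      term, and \<open>commuting\<close> exchanges s with \<open>t k\<close> on that term.\<close>
    have "g k \<in> carrier D \<and> s (g k) = f (trunc k (\<lambda>i. rmult R (\<eta> i) s))" if "k \<le> n" for k
      using that
    proof (induction k)
      case 0
      have "g 0 = \<zero>\<^bsub>D\<^esub>"
        by (simp add: g_def trunc_0 f_zero dual_simps(1))
      then show ?case
        by (simp add: trunc_0 f_zero s_zero)
    next
      case (Suc k)
      then have k: "k < n" "g k \<in> carrier D" "s (g k) = f (trunc k (\<lambda>i. rmult R (\<eta> i) s))"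
        by simp_all
      have "g (Suc k) = g k \<oplus>\<^bsub>D\<^esub> lmult R (t k) (\<eta> k)"
        unfolding dual_simps(2) g_def
        by (rule restrict_ext) (use k(1) \<eta> in \<open>simp add: f_trunc\<close>)
      moreover have "lmult R (t k) (\<eta> k) \<in> carrier D"
        using k(1) \<eta> t by simp
      moreover have "s (lmult R (t k) (\<eta> k)) = t k (rmult R (\<eta> k) s)"
        using k(1) \<eta> t comm by (simp add: commuting_def)
      ultimately show ?case
        using k \<eta> s by (simp add: bidualD(2)[OF s] f_trunc dual_add_closed)
    qed
    then have "s (g n) = f (trunc n (\<lambda>i. rmult R (\<eta> i) s))" by simp
    moreover have trunc_n: "trunc n u = restrict u I" for u
      by (auto simp: trunc_def I intro!: restrict_ext)
    \<comment> \<open>Since f vanishes on every \<open>v r\<close>, the full sum is the zero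
      functional. So s kills it, whereas its image under s is f w, which is nonzero.\<close>
    moreover have "g n = \<zero>\<^bsub>D\<^esub>"
      unfolding dual_simps(1) g_def
      by (rule restrict_ext) (use f(2) in \<open>simp add: trunc_n v_def\<close>)
    ultimately show False
      using f(3) s_zero by (simp add: w_def)
  qed
  then obtain r where r: "r \<in> carrier R" "w = v r" by blast
  then have "rmult R (\<eta> i) s = ract R (\<eta> i) r" if "i < n" for i
    using that r(2) unfolding w_def v_def restrict_eq_iff by (simp add: I)
  then show ?thesis
    using r(1) F_eq by blast
qed

lemma commuting_iff_interpolating:
  assumes "cogenerator TYPE(('a, 'b) test) (scalars C R) Z" and "s \<in> bidual R C Z"
  shows "commuting s \<longleftrightarrow> (\<forall>F \<subseteq> carrier D. finite F \<longrightarrow>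
    (\<exists>r\<in>carrier R. \<forall>\<rho>\<in>F. rmult R \<rho> s = ract R \<rho> r))" (is "_ \<longleftrightarrow> ?interp")
proof
  assume "commuting s"
  then show ?interp by (intro allI impI commuting_imp_interpolating[OF assms])
next
  assume ?interp
  then show "commuting s" by (intro interpolating_imp_commuting[OF assms(2)]) simp
qed

section \<open>Linearly compact algebras\<close>

lemma biend_eq_right_mult_by:
  assumes cog: "cogenerator TYPE(('a, 'b) test) (scalars C R) Z"
    and lc: "linearly_compact R (right_regular R)"
  shows "biend R D = right_mult_by R C Z ` carrier R"
proof (intro equalityI subsetI)
  fix b assume "b \<in> biend R D"
  then obtain s where s: "s \<in> bidual R C Z" "commuting s" and b: "b = right_mult_map R C Z s"
    using biend_is_right_mult by blast
  note interp = commuting_imp_interpolating[OF cog s]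
  have U: "carrier (right_regular R) = carrier R"
    "\<And>r x. r \<odot>\<^bsub>right_regular R\<^esub> x = x \<otimes> r"
    by (simp_all add: right_regular_def)
  \<comment> \<open>Subtraction depends only on the additive group, which
    \<open>right_regular\<close> shares with R.\<close>
  have U_minus: "x \<ominus>\<^bsub>right_regular R\<^esub> y = x \<ominus> y" for x y
    by (simp add: a_minus_def a_inv_def m_inv_def right_regular_def)
  \<comment> \<open>The annihilator of \<rho> in R, spelled out as the set of x such that \<rho>
    vanishes on x R.\<close>
  define N where "N \<rho> = {x \<in> carrier R. \<forall>y\<in>carrier R. \<rho> (x \<otimes> y) = \<zero>\<^bsub>Z\<^esub>}" for \<rho>
  have N_iff: "x \<ominus> u \<in> N \<rho> \<longleftrightarrow> ract R \<rho> x = ract R \<rho> u"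
    if "\<rho> \<in> carrier D" "x \<in> carrier R" "u \<in> carrier R" for \<rho> x u
  proof -
    have "\<rho> ((x \<ominus> u) \<otimes> y) = \<zero>\<^bsub>Z\<^esub> \<longleftrightarrow> \<rho> (x \<otimes> y) = \<rho> (u \<otimes> y)" if y: "y \<in> carrier R" for y
    proof -
      have "x \<otimes> y = (x \<ominus> u) \<otimes> y \<oplus> u \<otimes> y"
        using y \<open>x \<in> _\<close> \<open>u \<in> _\<close> by (simp add: minus_eq l_neg a_assoc flip: l_distr)
      then have "\<rho> (x \<otimes> y) = \<rho> ((x \<ominus> u) \<otimes> y) \<oplus>\<^bsub>Z\<^esub> \<rho> (u \<otimes> y)"
        using y that \<open>x \<in> _\<close> \<open>u \<in> _\<close> \<open>\<rho> \<in> _\<close> by (simp add: dualD)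
      then show ?thesis
        using y \<open>x \<in> _\<close> \<open>u \<in> _\<close> dualD(2)[OF \<open>\<rho> \<in> _\<close>] by simp
    qed
    then have "x \<ominus> u \<in> N \<rho> \<longleftrightarrow> (\<forall>y\<in>carrier R. \<rho> (x \<otimes> y) = \<rho> (u \<otimes> y))"
      using that by (simp add: N_def)
    also have "\<dots> \<longleftrightarrow> ract R \<rho> x = ract R \<rho> u"
      unfolding ract_def restrict_eq_iff ..
    finally show ?thesis .
  qed
  have N_submodule: "submodule (N \<rho>) R (right_regular R)" if \<rho>: "\<rho> \<in> carrier D" for \<rho>
  proof (intro submodule.intro submodule_axioms.intro)
    have "subgroup (N \<rho>) (add_monoid R)"
    proof (rule add.subgroupI)
      show "N \<rho> \<noteq> {}" using \<rho> by (auto simp: N_def dual_zero intro!: exI[of _ \<zero>])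
    next
      fix a assume a: "a \<in> N \<rho>"
      then have "a \<in> carrier R" by (simp add: N_def)
      \<comment> \<open>Membership of a is the equation \<rho> a = \<rho> 0 between functionals;
        reading it backwards gives membership of 0 - a.\<close>
      moreover from this have "ract R \<rho> a = ract R \<rho> \<zero>"
        using \<rho> a N_iff[of \<rho> a \<zero>] by (simp add: minus_eq)
      ultimately have "\<zero> \<ominus> a \<in> N \<rho>" using \<rho> N_iff[of \<rho> \<zero> a] by simp
      then show "\<ominus> a \<in> N \<rho>" using \<open>a \<in> carrier R\<close> by (simp add: minus_eq)
    qed (use \<rho> in \<open>auto simp: N_def l_distr dualD\<close>)
    then show "subgroup (N \<rho>) (add_monoid (right_regular R))"
      by (simp add: subgroup_def m_inv_def right_regular_def)
  qed (auto simp: N_def U m_assoc)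
  \<comment> \<open>All pairs for which u interpolates s at \<rho>; keeping every such u avoids
    choosing one. A common solution x of the relations x - u \<in> \<open>N \<rho>\<close> satisfies
    \<rho> x = \<rho> s for each \<rho> that occurs.\<close>
  define G where "G = {(\<rho>, u). \<rho> \<in> carrier D \<and> u \<in> carrier R \<and> rmult R \<rho> s = ract R \<rho> u}"
  define S where "S = (\<lambda>(\<rho>, u). (N \<rho>, u)) ` G"
  have "\<exists>x\<in>carrier (right_regular R). \<forall>(N, u)\<in>S. x \<ominus>\<^bsub>right_regular R\<^esub> u \<in> N"
  proof (rule lc[unfolded linearly_compact_def, THEN spec, THEN mp, THEN mp], intro subsetI)
    fix p assume "p \<in> S"
    then show "p \<in> {N. submodule N R (right_regular R)} \<times> carrier (right_regular R)"
      using N_submodule by (auto simp: S_def G_def U)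
  next
    show "\<forall>T\<subseteq>S. finite T \<longrightarrow>
      (\<exists>x\<in>carrier (right_regular R). \<forall>(N, u)\<in>T. x \<ominus>\<^bsub>right_regular R\<^esub> u \<in> N)"
    proof (intro allI impI)
      fix T assume T: "T \<subseteq> S" "finite T"
      \<comment> \<open>Finitely many relations come from finitely many pairs, and an element
        interpolating s on their functionals solves all of them.\<close>
      obtain H where H: "H \<subseteq> G" "finite H" "T = (\<lambda>(\<rho>, u). (N \<rho>, u)) ` H"
        using finite_subset_image[OF T(2) T(1)[unfolded S_def]] by blast
      have "fst ` H \<subseteq> carrier D" "finite (fst ` H)"
        using H(1,2) by (auto simp: G_def)
      then obtain x where x: "x \<in> carrier R" "\<forall>\<rho>\<in>fst ` H. rmult R \<rho> s = ract R \<rho> x"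
        using interp[of "fst ` H"] by blast
      have "x \<ominus> u \<in> N \<rho>" if \<rho>u: "(\<rho>, u) \<in> H" for \<rho> u
      proof -
        have "\<rho> \<in> carrier D" "u \<in> carrier R" "rmult R \<rho> s = ract R \<rho> u"
          using \<rho>u H(1) by (auto simp: G_def)
        moreover have "\<rho> \<in> fst ` H" using \<rho>u by force
        ultimately show ?thesis using x N_iff[of \<rho> x u] by metis
      qed
      then show "\<exists>x\<in>carrier (right_regular R). \<forall>(N, u)\<in>T. x \<ominus>\<^bsub>right_regular R\<^esub> u \<in> N"
        using x(1) unfolding H(3) U(1) U_minus by (intro bexI[of _ x]) auto
    qed
  qed
  then obtain x where x: "x \<in> carrier R" "\<forall>(N, u)\<in>S. x \<ominus> u \<in> N"
    unfolding U(1) U_minus by (rule bexE)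
  have "rmult R \<rho> s = ract R \<rho> x" if \<rho>: "\<rho> \<in> carrier D" for \<rho>
  proof -
    \<comment> \<open>Interpolation at \<rho> alone shows that \<rho> occurs in \<open>G\<close>, so
      the relations do constrain x at \<rho>.\<close>
    obtain u where u: "u \<in> carrier R" "rmult R \<rho> s = ract R \<rho> u"
      using interp[of "{\<rho>}"] \<rho> by auto
    have "(\<rho>, u) \<in> G" using u \<rho> by (simp add: G_def)
    then have "x \<ominus> u \<in> N \<rho>" using x(2) by (auto simp: S_def)
    then show ?thesis using x(1) u \<rho> N_iff[of \<rho> x u] by simp
  qed
  then have "b = right_mult_by R C Z x"
    by (simp add: b right_mult_map_def right_mult_by_def cong: restrict_cong)
  then show "b \<in> right_mult_by R C Z ` carrier R" using x(1) by blast
qed (use right_mult_by_biend in auto)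

end

theorem proposition6p1:
  fixes R :: "('a, 'x) ring_scheme" and C :: "'a set" and Z :: "('a, 'b, 'y) module_scheme"
  assumes "C_algebra C R"
    and "injective_module TYPE(('a, 'b) test) (scalars C R) Z"
    and "cogenerator TYPE(('a, 'b) test) (scalars C R) Z"
  shows
    "(mod_hom R (dual R C Z) (dual R C Z) = left_mult_map R C Z ` full_bidual R C Z
      \<and> biend R (dual R C Z) =
          right_mult_map R C Z `
            {s \<in> bidual R C Z. \<forall>t\<in>full_bidual R C Z. arens_dot R C Z s t = arens_diamond R C Z s t})
     \<and> biend R (dual R C Z) =
          right_mult_map R C Z `
            {s \<in> bidual R C Z. \<forall>F \<subseteq> carrier (dual R C Z). finite F \<longrightarrow>
               (\<exists>r\<in>carrier R. \<forall>\<rho>\<in>F. rmult R \<rho> s = ract R \<rho> r)}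
     \<and> (linearly_compact R (right_regular R) \<longrightarrow>
          biend R (dual R C Z) = right_mult_by R C Z ` carrier R)"
proof -
  interpret algebra_dual R C Z
    using assms(1,3) unfolding C_algebra_def cogenerator_def
    by (intro algebra_dual.intro algebra_dual_axioms.intro) blast+
  \<comment> \<open>The descriptions of the biendomorphisms in (i) and (ii) use the same set of
    functionals s, so (ii) reduces to (i).\<close>
  have interp: "{s \<in> bidual R C Z. commuting s} =
      {s \<in> bidual R C Z. \<forall>F \<subseteq> carrier D. finite F \<longrightarrow>
        (\<exists>r\<in>carrier R. \<forall>\<rho>\<in>F. rmult R \<rho> s = ract R \<rho> r)}"
    by (intro Collect_cong conj_cong refl commuting_iff_interpolating[OF assms(3)])
  show ?thesis
    unfolding arens_eq_iff_commuting interp[symmetric]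
    by (intro conjI impI End_eq_left_mult biend_eq biend_eq_right_mult_by[OF assms(3)])
qed

end
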